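(* Let $n \geq 3$ be an integer, let $\mathbb{R}^n$ be the $n$-dimensional Euclidean space with Euclidean norm $\|\cdot\|$ and standard basis $\{e_1, \ldots, e_n\}$, and let $d \geq 1$ be a real number. Let $D$ be a subset of $\mathbb{R}^n$ with $\{0, e_1, \ldots, e_n\} \subset D \subset B_d(0)$, where $B_d(0) = \{x \in \mathbb{R}^n : \|x\| \leq d\}$. Let $\varepsilon$ be a real number with $$0 < \varepsilon < \min\Big\{ \frac{1}{\sigma},\ \min_{1 \leq i \leq n} \frac{1}{2c_{ii}},\ \frac{1}{12} \Big\}, \qquad \sigma = \sum_{i=1}^{n-1} c_{(i+1)i}^2,$$ where the positive integers $c_{ij}$ ($1 \leq j \leq i \leq n$) are those determined from $\varepsilon$ and $n$ by the recursion given in the context. Let $f : D \to \mathbb{R}^n$ be a function satisfying $f(0) = 0$ and $$\big| \|f(x) - f(y)\| - \|x - y\| \big| \leq \varepsilon \quad \text{for all } x, y \in D.$$ Then there exists an isometry $U : D \to \mathbb{R}^n$ such that $$\|f(x) - U(x)\| \leq \left[ \sum_{i=1}^n \left( \Big( 2 + \sum_{j=1}^i c_{ij} \Big) d + 4 + \sum_{j=1}^i c_{ij} \right)^2 \right]^{1/2} \varepsilon$$ for all $x \in D$.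
   Context: An isometry $U : D \to \mathbb{R}^n$ is a map with $\|U(x) - U(y)\| = \|x - y\|$ for all $x, y \in D$ (surjectivity is not required). The integers $c_{ij}$, $1 \leq j \leq i \leq n$. Given $\varepsilon > 0$ and $n$, they are determined recursively in the order $c_{11}, c_{21}, c_{22}, c_{32}, c_{33}, \ldots, c_{n(n-1)}, c_{nn}$ as follows. (1) $c_{11} = 1$, and for $j \in \{2, \ldots, n\}$, $c_{jj}$ is the smallest positive integer satisfying $$(3c_{jj} - 1)(c_{jj} - 1) \geq \sum_{i=1}^{j-1} c_{(i+1)i}^2.$$ (2) For $k \in \{1, \ldots, n-1\}$, $c_{(k+1)k}$ is the smallest positive integer satisfying $$\frac{1}{2(1 - c_{kk}\varepsilon)} \left( 4 + 2\sqrt{2} + \varepsilon + 2 \sum_{i=1}^{k-1} c_{ki}\, c_{(k+1)i}\, \varepsilon \right) \leq c_{(k+1)k}.$$ (3) For $1 \leq j < i \leq n$, $c_{ij} = c_{(j+1)j}$ (entries below the diagonal depend only on the column index $j$); in particular $c_{ki} c_{(k+1)i} = c_{(i+1)i}^2$ in (2). The assumed upper bound on $\varepsilon$ is a condition on $\varepsilon$ together with the integers $c_{ij}$ it determines; it includes $c_{kk}\varepsilon < \frac12$ for every $k$, so that step (2) makes sense. *)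

theory Defs
  imports "HOL-Analysis.Analysis"
begin

text \<open>The isometry need not be onto; only the values of \<open>U\<close> on \<open>D\<close> matter.\<close>

definition isometry_on :: "'a::real_normed_vector set \<Rightarrow> ('a \<Rightarrow> 'b::real_normed_vector) \<Rightarrow> bool"
  where "isometry_on D U \<longleftrightarrow> (\<forall>x\<in>D. \<forall>y\<in>D. norm (U x - U y) = norm (x - y))"

text \<open>
  The triangular array \<open>c\<^sub>i\<^sub>j\<close>, used for \<open>1 \<le> j \<le> i \<le> n\<close>. The entries do not depend on \<open>n\<close>,
  so the array is defined for all indices at once; it is \<open>0\<close> outside \<open>1 \<le> j \<le> i\<close>.
  In the case \<open>i = j + 1\<close> the formula is only meaningful if \<open>c\<^sub>j\<^sub>j * \<epsilon> < 1\<close>.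
\<close>

function stab_coeff :: "real \<Rightarrow> nat \<Rightarrow> nat \<Rightarrow> nat" where
  "stab_coeff \<epsilon> i j =
    (if j = 0 \<or> i < j then 0
     else if i = 1 \<and> j = 1 then 1
     else if i = j then
       (LEAST m. 0 < m \<and>
          (3 * real m - 1) * (real m - 1) \<ge> (\<Sum>l=1..<j. (real (stab_coeff \<epsilon> (l + 1) l))\<^sup>2))
     else if i = j + 1 then
       (LEAST m. 0 < m \<and>
          1 / (2 * (1 - real (stab_coeff \<epsilon> j j) * \<epsilon>)) *
            (4 + 2 * sqrt 2 + \<epsilon>
              + 2 * (\<Sum>l=1..<j. real (stab_coeff \<epsilon> j l) * real (stab_coeff \<epsilon> (j + 1) l) * \<epsilon>))
          \<le> real m)
     else stab_coeff \<epsilon> (j + 1) j)"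
  by pat_completeness auto
termination
  by (relation "Wellfounded.measure (\<lambda>(\<epsilon>, i, j). 3 * j + (if i = j then 0 else if i = j + 1 then 1 else 2))")
    auto

declare stab_coeff.simps [simp del]

definition stab_sigma :: "real \<Rightarrow> nat \<Rightarrow> real"
  where "stab_sigma \<epsilon> n = (\<Sum>i=1..n-1. (real (stab_coeff \<epsilon> (i + 1) i))\<^sup>2)"

end

theory Submission
  imports Defs
begin

text \<open>
  Polarization expresses inner products through distances, so a map \<open>f\<close> that fixes \<open>0\<close> and
  distorts distances by at most \<open>\<epsilon>\<close> distorts inner products by \<open>O(\<epsilon>)\<close>
  (\<open>inner_perturbation\<close>). The vectors \<open>v\<^sub>i = f e\<^sub>i\<close> are thus almost orthonormal. Orthonormalizing them
  gives an orthonormal basis \<open>u\<^sub>1, \<dots>, u\<^sub>n\<close> in which the matrix \<open>(v\<^sub>i \<bullet> u\<^sub>j)\<close> is lower triangular with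
  nonnegative diagonal (\<open>orthonormal_triangularization\<close>), and the isometry is the linear map taking
  \<open>e\<^sub>i\<close> to \<open>u\<^sub>i\<close>.

  The recursion for \<open>c\<^sub>i\<^sub>j\<close> is what makes \<open>c\<^sub>i\<^sub>j * \<epsilon>\<close> bound the distance of this matrix from the
  identity, column by column (\<open>triangular_coefficients_bound\<close>): the condition on \<open>c\<^sub>j\<^sub>j\<close> turns
  \<open>norm v\<^sub>j \<ge> 1 - \<epsilon>\<close> into a lower bound for the diagonal entry, and the condition on \<open>c\<^sub>(\<^sub>j\<^sub>+\<^sub>1\<^sub>)\<^sub>j\<close> turns the
  smallness of \<open>v\<^sub>i \<bullet> v\<^sub>j\<close> into a bound for the entries below it.

  Finally fix \<open>x\<close>. The number \<open>f x \<bullet> v\<^sub>i\<close> is \<open>O(\<epsilon>)\<close>-close to the \<open>i\<close>-th coordinate of \<open>x\<close>. Expanding it in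
  the basis \<open>u\<close> and replacing row \<open>i\<close> of the matrix by row \<open>i\<close> of the identity costs at most
  \<open>\<epsilon> * norm (f x)\<close> times the sum of \<open>c\<^sub>i\<^sub>j\<close> over \<open>j \<le> i\<close>. This bounds each coordinate of \<open>f x - U x\<close>, and
  Parseval's identity assembles the coordinates.
\<close>

section \<open>Inner products under almost isometries\<close>

text \<open>
  Let \<open>t, s, r\<close> be the distortions of \<open>norm x\<close>, \<open>norm y\<close> and \<open>p = norm (x - y)\<close>. By polarization, twice
  the error is \<open>(2t * norm x + t\<^sup>2) + (2s * norm y + s\<^sup>2) - (2rp + r\<^sup>2)\<close>. For the sharper estimate, note
  that \<open>2rp + r\<^sup>2\<close> is increasing in \<open>r \<ge> -p\<close>, so if \<open>\<epsilon> \<le> p\<close> its least value for \<open>\<bar>r\<bar> \<le> \<epsilon>\<close> is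
  \<open>\<epsilon>\<^sup>2 - 2\<epsilon>p\<close>, whose square cancels one of the two positive ones. The recursion for the
  subdiagonal coefficients leaves room for a single \<open>\<epsilon>\<^sup>2\<close> only and needs this form.
\<close>

lemma inner_perturbation:
  fixes x y x' y' :: "'a::real_inner" and \<epsilon> :: real
  assumes x: "\<bar>norm x' - norm x\<bar> \<le> \<epsilon>" and y: "\<bar>norm y' - norm y\<bar> \<le> \<epsilon>"
    and xy: "\<bar>norm (x' - y') - norm (x - y)\<bar> \<le> \<epsilon>"
  shows "\<bar>x' \<bullet> y' - x \<bullet> y\<bar> \<le> \<epsilon> * (norm x + norm y + norm (x - y) + \<epsilon>)"
    and "\<epsilon> \<le> norm (x - y) \<Longrightarrow>
      \<bar>x' \<bullet> y' - x \<bullet> y\<bar> \<le> \<epsilon> * (norm x + norm y + norm (x - y) + \<epsilon> / 2)"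
proof -
  define r s t p where "r = norm (x' - y') - norm (x - y)" and "s = norm y' - norm y"
    and "t = norm x' - norm x" and "p = norm (x - y)"
  have polar: "2 * (a \<bullet> b) = (norm a)\<^sup>2 + (norm b)\<^sup>2 - (norm (a - b))\<^sup>2" for a b :: 'a
    by (simp add: power2_norm_eq_inner inner_diff inner_commute)
  have norms: "norm x' = norm x + t" "norm y' = norm y + s" "norm (x' - y') = p + r"
    by (simp_all add: r_def s_def t_def p_def)
  have eq: "2 * (x' \<bullet> y' - x \<bullet> y)
      = (2 * (t * norm x) + t\<^sup>2) + (2 * (s * norm y) + s\<^sup>2) - (2 * (r * p) + r\<^sup>2)"
    using polar[of x' y'] polar[of x y] unfolding norms p_def[symmetric]
    by (simp add: power2_eq_square algebra_simps)
  have eps: "0 \<le> \<epsilon>" using x by linarith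
  have rst: "\<bar>r\<bar> \<le> \<epsilon>" "\<bar>s\<bar> \<le> \<epsilon>" "\<bar>t\<bar> \<le> \<epsilon>"
    using assms by (simp_all add: r_def s_def t_def)
  have sq: "r\<^sup>2 \<le> \<epsilon>\<^sup>2" "s\<^sup>2 \<le> \<epsilon>\<^sup>2" "t\<^sup>2 \<le> \<epsilon>\<^sup>2"
    using rst eps by (metis abs_le_square_iff abs_of_nonneg)+
  have nn: "0 \<le> r\<^sup>2" "0 \<le> s\<^sup>2" "0 \<le> t\<^sup>2" by simp_all
  have lin: "\<bar>a * b\<bar> \<le> \<epsilon> * b" if "\<bar>a\<bar> \<le> \<epsilon>" "0 \<le> b" for a b
    using that by (simp add: abs_mult mult_right_mono)
  have lins: "\<bar>r * p\<bar> \<le> \<epsilon> * p" "\<bar>s * norm y\<bar> \<le> \<epsilon> * norm y" "\<bar>t * norm x\<bar> \<le> \<epsilon> * norm x"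
    using rst by (auto intro!: lin simp: p_def)
  note upper = lins[THEN abs_le_D1] and lower = lins[THEN abs_le_D2]
  have expand: "\<epsilon> * (norm x + norm y + norm (x - y) + \<epsilon>)
      = \<epsilon> * norm x + \<epsilon> * norm y + \<epsilon> * p + \<epsilon>\<^sup>2"
    "\<epsilon> * (norm x + norm y + norm (x - y) + \<epsilon> / 2)
      = \<epsilon> * norm x + \<epsilon> * norm y + \<epsilon> * p + \<epsilon>\<^sup>2 / 2"
    by (simp_all add: p_def power2_eq_square algebra_simps)
  show "\<bar>x' \<bullet> y' - x \<bullet> y\<bar> \<le> \<epsilon> * (norm x + norm y + norm (x - y) + \<epsilon>)"
    unfolding expand
  proof (rule abs_leI)
    show "x' \<bullet> y' - x \<bullet> y \<le> \<epsilon> * norm x + \<epsilon> * norm y + \<epsilon> * p + \<epsilon>\<^sup>2"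
      using eq sq(2,3) nn(1) upper(2,3) lower(1) by argo
    show "- (x' \<bullet> y' - x \<bullet> y) \<le> \<epsilon> * norm x + \<epsilon> * norm y + \<epsilon> * p + \<epsilon>\<^sup>2"
      using eq sq(1) nn lower(2,3) upper(1) by argo
  qed
  show "\<bar>x' \<bullet> y' - x \<bullet> y\<bar> \<le> \<epsilon> * (norm x + norm y + norm (x - y) + \<epsilon> / 2)"
    if "\<epsilon> \<le> norm (x - y)"
  proof -
    \<comment> \<open>the product is \<open>(2rp + r\<^sup>2)\<close> minus its value at \<open>r = -\<epsilon>\<close>\<close>
    have "0 \<le> (\<epsilon> + r) * (2 * p + r - \<epsilon>)"
      using that rst by (intro mult_nonneg_nonneg) (auto simp: p_def)
    then have "\<epsilon>\<^sup>2 - 2 * (\<epsilon> * p) \<le> 2 * (r * p) + r\<^sup>2"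
      by (simp add: power2_eq_square algebra_simps)
    then have "x' \<bullet> y' - x \<bullet> y \<le> \<epsilon> * norm x + \<epsilon> * norm y + \<epsilon> * p + \<epsilon>\<^sup>2 / 2"
      using eq sq(2,3) upper(2,3) by argo
    moreover have "- (x' \<bullet> y' - x \<bullet> y) \<le> \<epsilon> * norm x + \<epsilon> * norm y + \<epsilon> * p + \<epsilon>\<^sup>2 / 2"
      using eq sq(1) nn(2,3) lower(2,3) upper(1) by argo
    ultimately show ?thesis unfolding expand by (rule abs_leI)
  qed
qed

section \<open>Orthonormal systems\<close>

text \<open>
  The Gram-Schmidt process, also for dependent vectors: if \<open>v\<^sub>m\<close> lies in the span of its predecessors,
  any unit vector orthogonal to the earlier \<open>u\<^sub>j\<close> serves as \<open>u\<^sub>m\<close>, and the bound on \<open>m\<close> guarantees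
  that there is one.
\<close>

lemma orthonormal_triangularization:
  fixes v :: "nat \<Rightarrow> 'a::euclidean_space"
  assumes "m \<le> DIM('a)"
  shows "\<exists>u. (\<forall>i\<in>{1..m}. \<forall>j\<in>{1..m}. u i \<bullet> u j = (if i = j then 1 else 0)) \<and>
    (\<forall>i\<in>{1..m}. v i = (\<Sum>j=1..i. (v i \<bullet> u j) *\<^sub>R u j) \<and> 0 \<le> v i \<bullet> u i)"
  using assms
proof (induction m)
  case 0
  show ?case by simp
next
  case (Suc m)
  then have "m \<le> DIM('a)" by simp
  from Suc.IH[OF this] obtain u where
    "\<forall>i\<in>{1..m}. \<forall>j\<in>{1..m}. u i \<bullet> u j = (if i = j then 1 else 0)"
    "\<forall>i\<in>{1..m}. v i = (\<Sum>j=1..i. (v i \<bullet> u j) *\<^sub>R u j) \<and> 0 \<le> v i \<bullet> u i"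
    by blast
  then have orth: "\<And>i j. i \<in> {1..m} \<Longrightarrow> j \<in> {1..m} \<Longrightarrow> u i \<bullet> u j = (if i = j then 1 else 0)"
    and tri: "\<And>i. i \<in> {1..m} \<Longrightarrow> v i = (\<Sum>j=1..i. (v i \<bullet> u j) *\<^sub>R u j) \<and> 0 \<le> v i \<bullet> u i"
    by blast+
  define w where "w = v (Suc m) - (\<Sum>j=1..m. (v (Suc m) \<bullet> u j) *\<^sub>R u j)"
  have w_orth: "w \<bullet> u i = 0" if "i \<in> {1..m}" for i
  proof -
    have "(\<Sum>j=1..m. (v (Suc m) \<bullet> u j) * (u j \<bullet> u i)) = (\<Sum>j=1..m. if j = i then v (Suc m) \<bullet> u j else 0)"
      using that by (intro sum.cong) (auto simp: orth)
    then show ?thesis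
      using that by (simp add: w_def inner_diff_left inner_sum_left)
  qed
  obtain z where z: "norm z = 1" "\<And>i. i \<in> {1..m} \<Longrightarrow> z \<bullet> u i = 0" "w = norm w *\<^sub>R z"
  proof (cases "w = 0")
    case True
    have "dim (u ` {1..m}) < DIM('a)"
      using dim_le_card'[of "u ` {1..m}"] card_image_le[of "{1..m}" u] Suc.prems by simp
    then obtain y where y: "y \<noteq> 0" "\<And>x. x \<in> span (u ` {1..m}) \<Longrightarrow> orthogonal y x"
      using orthogonal_to_subspace_exists by metis
    have "orthogonal y (u i)" if "i \<in> {1..m}" for i
      using that by (intro y span_base) auto
    then show ?thesis
      using y(1) True by (intro that[of "y /\<^sub>R norm y"]) (auto simp: orthogonal_def)
  next
    case False
    then show ?thesis
      using w_orth by (intro that[of "w /\<^sub>R norm w"]) auto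
  qed
  have v_split: "v (Suc m) = (\<Sum>j=1..m. (v (Suc m) \<bullet> u j) *\<^sub>R u j) + norm w *\<^sub>R z"
    using z(3) by (simp add: w_def)
  have "v (Suc m) \<bullet> z
      = (\<Sum>j=1..m. (v (Suc m) \<bullet> u j) * (u j \<bullet> z)) + norm w * (z \<bullet> z)"
    by (subst v_split) (simp add: inner_add_left inner_sum_left)
  also have "\<dots> = norm w"
    using z(1,2) by (simp add: inner_commute norm_eq_1)
  finally have vz: "v (Suc m) \<bullet> z = norm w" .
  define u' where "u' = u(Suc m := z)"
  have old: "u' j = u j" if "j \<le> m" for j
    using that by (simp add: u'_def)
  have new: "u' (Suc m) = z" by (simp add: u'_def)
  have split: "i \<in> {1..Suc m} \<longleftrightarrow> i \<in> {1..m} \<or> i = Suc m" for i by auto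
  have "u' i \<bullet> u' j = (if i = j then 1 else 0)" if "i \<in> {1..Suc m}" "j \<in> {1..Suc m}" for i j
    using that z(1,2) orth unfolding split by (auto simp: old new inner_commute norm_eq_1)
  moreover have "v i = (\<Sum>j=1..i. (v i \<bullet> u' j) *\<^sub>R u' j) \<and> 0 \<le> v i \<bullet> u' i"
    if "i \<in> {1..Suc m}" for i
  proof (cases "i = Suc m")
    case True
    have "(\<Sum>j=1..m. (v i \<bullet> u' j) *\<^sub>R u' j) = (\<Sum>j=1..m. (v i \<bullet> u j) *\<^sub>R u j)"
      by (intro sum.cong) (auto simp: old)
    then show ?thesis
      using v_split vz unfolding True by (simp add: new)
  next
    case False
    then have i: "i \<in> {1..m}" using that by auto
    have "(\<Sum>j=1..i. (v i \<bullet> u' j) *\<^sub>R u' j) = (\<Sum>j=1..i. (v i \<bullet> u j) *\<^sub>R u j)"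
      using i by (intro sum.cong) (auto simp: old)
    then show ?thesis using tri[OF i] i by (auto simp: old)
  qed
  ultimately show ?case by blast
qed

lemma orthonormal_Parseval:
  fixes u :: "nat \<Rightarrow> 'a::euclidean_space"
  assumes orth: "\<And>i j. i \<in> {1..DIM('a)} \<Longrightarrow> j \<in> {1..DIM('a)} \<Longrightarrow> u i \<bullet> u j = (if i = j then 1 else 0)"
  shows "(norm x)\<^sup>2 = (\<Sum>i=1..DIM('a). (x \<bullet> u i)\<^sup>2)"
proof -
  let ?I = "{1..DIM('a)}"
  have inj: "inj_on u ?I"
    using orth by (intro inj_onI) (metis zero_neq_one)
  have pw: "pairwise orthogonal (u ` ?I)"
    using orth by (auto simp: pairwise_def orthogonal_def)
  have "0 \<notin> u ` ?I"
    using orth by (metis imageE inner_zero_left zero_neq_one)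
  then have ind: "independent (u ` ?I)"
    using pw by (rule pairwise_orthogonal_independent[rotated])
  have "UNIV \<subseteq> span (u ` ?I)"
    by (rule card_ge_dim_independent) (use ind inj in \<open>auto simp: card_image\<close>)
  moreover have "norm y = 1" if "y \<in> u ` ?I" for y
    using that orth by (auto simp: norm_eq_1)
  ultimately have "(\<Sum>y\<in>u ` ?I. (x \<bullet> y) *\<^sub>R y) = x"
    using pw by (intro orthonormal_basis_expand) auto
  then have x: "x = (\<Sum>i\<in>?I. (x \<bullet> u i) *\<^sub>R u i)"
    by (subst (asm) sum.reindex[OF inj]) simp
  have "(norm x)\<^sup>2 = x \<bullet> (\<Sum>i\<in>?I. (x \<bullet> u i) *\<^sub>R u i)"
    using x by (simp add: power2_norm_eq_inner)
  then show ?thesis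
    by (simp add: inner_sum_right power2_eq_square)
qed

section \<open>The coefficients and the triangular matrix\<close>

lemma stab_coeff_column:
  assumes "1 \<le> j" "j < i"
  shows "stab_coeff \<epsilon> i j = stab_coeff \<epsilon> (j + 1) j"
  using assms by (cases "i = j + 1") (simp_all add: stab_coeff.simps[of \<epsilon> i j])

text \<open>
  The least positive integers in the definition of the coefficients exist, since both conditions
  hold for all large integers; so the coefficients satisfy the inequalities they are minimal for.
\<close>

lemma stab_coeff_diagonal:
  assumes "1 \<le> j"
  shows "0 < stab_coeff \<epsilon> j j"
    and "(\<Sum>l=1..<j. (real (stab_coeff \<epsilon> (l + 1) l))\<^sup>2)
      \<le> (3 * real (stab_coeff \<epsilon> j j) - 1) * (real (stab_coeff \<epsilon> j j) - 1)"
proof -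
  let ?S = "\<Sum>l=1..<j. (real (stab_coeff \<epsilon> (l + 1) l))\<^sup>2"
  let ?P = "\<lambda>m. 0 < m \<and> ?S \<le> (3 * real m - 1) * (real m - 1)"
  have "?P (stab_coeff \<epsilon> j j)"
  proof (cases "j = 1")
    case True
    then show ?thesis by (simp add: stab_coeff.simps)
  next
    case False
    have S: "0 \<le> ?S" by (intro sum_nonneg) simp
    obtain m where m: "?S + 1 \<le> real m" using real_arch_simple by blast
    have "1 * ?S \<le> (3 * real m - 1) * (real m - 1)"
      using m S by (intro mult_mono) auto
    then have "?P m" using m S by auto
    then have "?P (LEAST m. ?P m)" by (rule LeastI)
    moreover have "stab_coeff \<epsilon> j j = (LEAST m. ?P m)"
      using assms False by (subst stab_coeff.simps) simp
    ultimately show ?thesis by simp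
  qed
  then show "0 < stab_coeff \<epsilon> j j"
    and "?S \<le> (3 * real (stab_coeff \<epsilon> j j) - 1) * (real (stab_coeff \<epsilon> j j) - 1)"
    by auto
qed

lemma stab_coeff_subdiagonal:
  assumes "1 \<le> j"
  shows "1 / (2 * (1 - real (stab_coeff \<epsilon> j j) * \<epsilon>)) *
      (4 + 2 * sqrt 2 + \<epsilon>
        + 2 * (\<Sum>l=1..<j. real (stab_coeff \<epsilon> j l) * real (stab_coeff \<epsilon> (j + 1) l) * \<epsilon>))
    \<le> real (stab_coeff \<epsilon> (j + 1) j)" (is "?q \<le> _")
proof -
  obtain m where "max 1 ?q \<le> real m" using real_arch_simple by blast
  then have "0 < m \<and> ?q \<le> real m" by auto
  then have "0 < (LEAST m. 0 < m \<and> ?q \<le> real m) \<and> ?q \<le> real (LEAST m. 0 < m \<and> ?q \<le> real m)"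
    by (rule LeastI)
  moreover have "stab_coeff \<epsilon> (j + 1) j = (LEAST m. 0 < m \<and> ?q \<le> real m)"
    using assms by (subst stab_coeff.simps) simp
  ultimately show ?thesis by simp
qed

text \<open>
  Strong induction on the column \<open>j\<close>. Write \<open>a\<^sub>i\<^sub>l = v\<^sub>i \<bullet> u\<^sub>l\<close>. Since \<open>a\<^sub>j\<^sub>j\<^sup>2\<close> is the square of \<open>norm v\<^sub>j\<close>
  minus the squares of the earlier entries of row \<open>j\<close>, it is at least \<open>(1 - \<epsilon>)\<^sup>2 - S * \<epsilon>\<^sup>2\<close>, where \<open>S\<close>
  is the sum of squares in the recursion for \<open>c\<^sub>j\<^sub>j\<close>. For \<open>i > j\<close>, the product \<open>a\<^sub>i\<^sub>j * a\<^sub>j\<^sub>j\<close> is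
  \<open>v\<^sub>i \<bullet> v\<^sub>j\<close> minus the products \<open>a\<^sub>i\<^sub>l * a\<^sub>j\<^sub>l\<close> from earlier columns, and it can be divided by \<open>a\<^sub>j\<^sub>j\<close>
  because the latter is already bounded below. The expansion of \<open>y \<bullet> v\<^sub>i\<close> for arbitrary \<open>y\<close> encodes
  triangularity and yields both identities (\<open>y = v\<^sub>j\<close> and \<open>y = v\<^sub>i\<close>).
\<close>

lemma triangular_coefficients_bound:
  fixes v u :: "nat \<Rightarrow> 'a::real_inner" and \<epsilon> :: real
  assumes eps: "0 < \<epsilon>" "\<epsilon> \<le> 1"
    and norm_v: "\<And>i. i \<in> {1..n} \<Longrightarrow> 1 - \<epsilon> \<le> norm (v i)"
    and inner_v: "\<And>i j. i \<in> {1..n} \<Longrightarrow> j \<in> {1..n} \<Longrightarrow> i \<noteq> j \<Longrightarrow>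
      2 * \<bar>v i \<bullet> v j\<bar> \<le> (4 + 2 * sqrt 2 + \<epsilon>) * \<epsilon>"
    and diag: "\<And>i. i \<in> {1..n} \<Longrightarrow> 2 * (real (stab_coeff \<epsilon> i i) * \<epsilon>) < 1"
    and tri: "\<And>i y. i \<in> {1..n} \<Longrightarrow> y \<bullet> v i = (\<Sum>j=1..i. (v i \<bullet> u j) * (y \<bullet> u j))"
    and pos: "\<And>i. i \<in> {1..n} \<Longrightarrow> 0 \<le> v i \<bullet> u i"
  shows "j \<in> {1..n} \<Longrightarrow> 1 - real (stab_coeff \<epsilon> j j) * \<epsilon> \<le> v j \<bullet> u j \<and>
    (\<forall>i\<in>{j<..n}. \<bar>v i \<bullet> u j\<bar> \<le> real (stab_coeff \<epsilon> i j) * \<epsilon>)"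
proof (induction j rule: less_induct)
  case (less j)
  define c where "c = real (stab_coeff \<epsilon> j j)"
  have j1: "1 \<le> j" using less.prems by simp
  have c1: "1 \<le> c"
    using stab_coeff_diagonal(1)[OF j1, of \<epsilon>] by (simp add: c_def)
  have ce: "2 * (c * \<epsilon>) < 1" using diag[OF less.prems] by (simp add: c_def)
  have IH: "\<bar>v i \<bullet> u l\<bar> \<le> real (stab_coeff \<epsilon> (l + 1) l) * \<epsilon>"
    if "l \<in> {1..<j}" "i \<in> {j..n}" for i l
  proof -
    have "\<bar>v i \<bullet> u l\<bar> \<le> real (stab_coeff \<epsilon> i l) * \<epsilon>"
      using less.IH[of l] that by auto
    then show ?thesis using that stab_coeff_column[of l i \<epsilon>] by simp
  qed
  have split: "{1..j} = insert j {1..<j}" using j1 by auto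
  have diag_bound: "1 - c * \<epsilon> \<le> v j \<bullet> u j"
  proof -
    define S where "S = (\<Sum>l=1..<j. (real (stab_coeff \<epsilon> (l + 1) l))\<^sup>2)"
    have "(\<Sum>l=1..<j. (v j \<bullet> u l)\<^sup>2) \<le> (\<Sum>l=1..<j. (real (stab_coeff \<epsilon> (l + 1) l) * \<epsilon>)\<^sup>2)"
    proof (rule sum_mono)
      fix l assume "l \<in> {1..<j}"
      then have "\<bar>v j \<bullet> u l\<bar> \<le> \<bar>real (stab_coeff \<epsilon> (l + 1) l) * \<epsilon>\<bar>"
        using IH[of l j] less.prems eps by (simp add: abs_mult)
      then show "(v j \<bullet> u l)\<^sup>2 \<le> (real (stab_coeff \<epsilon> (l + 1) l) * \<epsilon>)\<^sup>2"
        by (simp only: abs_le_square_iff)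
    qed
    also have "\<dots> = S * \<epsilon>\<^sup>2"
      by (simp add: S_def sum_distrib_right power_mult_distrib)
    finally have sum_le: "(\<Sum>l=1..<j. (v j \<bullet> u l)\<^sup>2) \<le> S * \<epsilon>\<^sup>2" .
    have "(1 - \<epsilon>)\<^sup>2 \<le> (norm (v j))\<^sup>2"
      using norm_v[OF less.prems] eps by (intro power_mono) auto
    also have "\<dots> = (v j \<bullet> u j)\<^sup>2 + (\<Sum>l=1..<j. (v j \<bullet> u l)\<^sup>2)"
      unfolding power2_norm_eq_inner tri[OF less.prems, of "v j"] split
      by (simp add: power2_eq_square)
    finally have lower: "(1 - \<epsilon>)\<^sup>2 - S * \<epsilon>\<^sup>2 \<le> (v j \<bullet> u j)\<^sup>2" using sum_le by linarith
    have "S \<le> (3 * c - 1) * (c - 1)"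
      using stab_coeff_diagonal(2)[OF j1, of \<epsilon>] by (simp add: S_def c_def)
    then have "S * \<epsilon>\<^sup>2 \<le> (3 * c - 1) * (c - 1) * \<epsilon>\<^sup>2"
      by (intro mult_right_mono) auto
    \<comment> \<open>With \<open>S\<close> replaced by its bound, this product is exactly \<open>(1 - \<epsilon>)\<^sup>2 - S * \<epsilon>\<^sup>2 - (1 - c * \<epsilon>)\<^sup>2\<close>;
      here the condition \<open>c * \<epsilon> < 1 / 2\<close> enters.\<close>
    moreover have "0 \<le> 2 * \<epsilon> * (c - 1) * (1 - 2 * (c * \<epsilon>))"
      using eps c1 ce by (intro mult_nonneg_nonneg) auto
    ultimately have "(1 - c * \<epsilon>)\<^sup>2 \<le> (1 - \<epsilon>)\<^sup>2 - S * \<epsilon>\<^sup>2"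
      by (simp add: power2_eq_square algebra_simps)
    then have "(1 - c * \<epsilon>)\<^sup>2 \<le> (v j \<bullet> u j)\<^sup>2" using lower by linarith
    then show ?thesis using pos[OF less.prems] by (rule power2_le_imp_le)
  qed
  have "\<bar>v i \<bullet> u j\<bar> \<le> real (stab_coeff \<epsilon> i j) * \<epsilon>" if i: "i \<in> {j<..n}" for i
  proof -
    define T where "T = (\<Sum>l=1..<j. real (stab_coeff \<epsilon> j l) * real (stab_coeff \<epsilon> (j + 1) l) * \<epsilon>)"
    define K where "K = 4 + 2 * sqrt 2 + \<epsilon> + 2 * T"
    have T: "\<bar>\<Sum>l=1..<j. (v j \<bullet> u l) * (v i \<bullet> u l)\<bar> \<le> T * \<epsilon>"
      unfolding T_def sum_distrib_right
    proof (rule sum_abs[THEN order_trans], rule sum_mono)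
      fix l assume l: "l \<in> {1..<j}"
      have "\<bar>v j \<bullet> u l\<bar> * \<bar>v i \<bullet> u l\<bar>
          \<le> (real (stab_coeff \<epsilon> (l + 1) l) * \<epsilon>) * (real (stab_coeff \<epsilon> (l + 1) l) * \<epsilon>)"
        using l i eps less.prems by (intro mult_mono IH) auto
      also have "\<dots> = real (stab_coeff \<epsilon> j l) * real (stab_coeff \<epsilon> (j + 1) l) * \<epsilon> * \<epsilon>"
        using l stab_coeff_column[of l j \<epsilon>] stab_coeff_column[of l "j + 1" \<epsilon>] by simp
      finally show "\<bar>(v j \<bullet> u l) * (v i \<bullet> u l)\<bar>
          \<le> real (stab_coeff \<epsilon> j l) * real (stab_coeff \<epsilon> (j + 1) l) * \<epsilon> * \<epsilon>"
        by (simp add: abs_mult)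
    qed
    have "v i \<bullet> v j = (v j \<bullet> u j) * (v i \<bullet> u j) + (\<Sum>l=1..<j. (v j \<bullet> u l) * (v i \<bullet> u l))"
      unfolding tri[OF less.prems, of "v i"] split by simp
    moreover have "2 * \<bar>v i \<bullet> v j\<bar> \<le> (4 + 2 * sqrt 2 + \<epsilon>) * \<epsilon>"
      using inner_v[of i j] i less.prems by auto
    moreover have "K * \<epsilon> = (4 + 2 * sqrt 2 + \<epsilon>) * \<epsilon> + 2 * (T * \<epsilon>)"
      by (simp add: K_def algebra_simps)
    ultimately have "2 * \<bar>(v j \<bullet> u j) * (v i \<bullet> u j)\<bar> \<le> K * \<epsilon>"
      using T by linarith
    moreover have "(1 - c * \<epsilon>) * \<bar>v i \<bullet> u j\<bar> \<le> \<bar>(v j \<bullet> u j) * (v i \<bullet> u j)\<bar>"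
      unfolding abs_mult using diag_bound by (intro mult_right_mono) auto
    ultimately have "2 * (1 - c * \<epsilon>) * \<bar>v i \<bullet> u j\<bar> \<le> K * \<epsilon>" by linarith
    then have "\<bar>v i \<bullet> u j\<bar> \<le> 1 / (2 * (1 - c * \<epsilon>)) * K * \<epsilon>"
      using ce by (simp add: pos_le_divide_eq mult.commute)
    also have "\<dots> \<le> real (stab_coeff \<epsilon> (j + 1) j) * \<epsilon>"
      using stab_coeff_subdiagonal[OF j1, of \<epsilon>] eps
      unfolding K_def T_def c_def by (intro mult_right_mono) auto
    finally show ?thesis using stab_coeff_column[of j i \<epsilon>] i j1 by simp
  qed
  with diag_bound show ?case by (auto simp: c_def)
qed

section \<open>Stability of isometries on bounded sets\<close>

theorem theorem4p1:
  fixes n :: nat and d \<epsilon> :: real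
    and D :: "(real ^ 'n) set" and f :: "real ^ 'n \<Rightarrow> real ^ 'n"
  assumes "CARD('n) = n" and "n \<ge> 3"
    and "d \<ge> 1"
    and "insert 0 (range (\<lambda>i. axis i 1)) \<subseteq> D" and "D \<subseteq> cball 0 d"
    and "0 < \<epsilon>"
    and "\<epsilon> < Min {1 / stab_sigma \<epsilon> n, Min ((\<lambda>i. 1 / (2 * real (stab_coeff \<epsilon> i i))) ` {1..n}), 1 / 12}"
    and "f 0 = 0"
    and "\<forall>x\<in>D. \<forall>y\<in>D. \<bar>norm (f x - f y) - norm (x - y)\<bar> \<le> \<epsilon>"
  shows "\<exists>U :: real ^ 'n \<Rightarrow> real ^ 'n. isometry_on D U \<and>
    (\<forall>x\<in>D. norm (f x - U x) \<le>
      sqrt (\<Sum>i=1..n. ((2 + (\<Sum>j=1..i. real (stab_coeff \<epsilon> i j))) * d + 4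
                        + (\<Sum>j=1..i. real (stab_coeff \<epsilon> i j)))\<^sup>2) * \<epsilon>)"
proof -
  let ?c = "stab_coeff \<epsilon>"
  have dim: "DIM(real ^ 'n) = n" using assms(1) by simp
  have eps0: "0 < \<epsilon>" by fact
  have eps1: "\<epsilon> < 1 / 12"
    and epsc: "\<epsilon> < Min ((\<lambda>i. 1 / (2 * real (?c i i))) ` {1..n})"
    using assms(7) by auto
  have diag: "2 * (real (?c i i) * \<epsilon>) < 1" if "i \<in> {1..n}" for i
  proof -
    have "\<epsilon> < 1 / (2 * real (?c i i))"
      using epsc that by (subst (asm) Min_gr_iff) auto
    then show ?thesis
      using stab_coeff_diagonal(1)[of i \<epsilon>] that by (simp add: field_simps)
  qed
  obtain b where b: "bij_betw b {1..n} (UNIV :: 'n set)"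
    using assms(1) by (metis card_atLeastAtMost diff_Suc_1 finite finite_atLeastAtMost finite_same_card_bij)
  define e :: "nat \<Rightarrow> real ^ 'n" where "e = (\<lambda>i. axis (b i) 1)"
  have bij_eq: "b i = b j \<longleftrightarrow> i = j" if "i \<in> {1..n}" "j \<in> {1..n}" for i j
    using b that by (auto simp: bij_betw_def inj_on_eq_iff)
  have e_orth: "e i \<bullet> e j = (if i = j then 1 else 0)" if "i \<in> {1..n}" "j \<in> {1..n}" for i j
    using bij_eq[OF that] by (simp add: e_def inner_axis_axis)
  have norm_e: "norm (e i) = 1" for i by (simp add: e_def)
  have dist_e: "norm (e i - e j) = sqrt 2" if "i \<in> {1..n}" "j \<in> {1..n}" "i \<noteq> j" for i j
    using that by (simp add: norm_eq_sqrt_inner inner_diff e_orth)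
  have e_D: "e i \<in> D" for i using assms(4) by (auto simp: e_def)
  have zero_D: "0 \<in> D" using assms(4) by auto
  have f_dist: "\<bar>norm (f x - f y) - norm (x - y)\<bar> \<le> \<epsilon>" if "x \<in> D" "y \<in> D" for x y
    using assms(9) that by blast
  have f_norm: "\<bar>norm (f x) - norm x\<bar> \<le> \<epsilon>" if "x \<in> D" for x
    using f_dist[OF that zero_D] by (simp add: \<open>f 0 = 0\<close>)
  define v where "v = (\<lambda>i. f (e i))"
  obtain u where u_orth: "\<And>i j. i \<in> {1..n} \<Longrightarrow> j \<in> {1..n} \<Longrightarrow> u i \<bullet> u j = (if i = j then 1 else 0)"
    and u_tri: "\<And>i. i \<in> {1..n} \<Longrightarrow> v i = (\<Sum>j=1..i. (v i \<bullet> u j) *\<^sub>R u j) \<and> 0 \<le> v i \<bullet> u i"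
    using orthonormal_triangularization[of n v] dim by force
  have parseval: "(norm x)\<^sup>2 = (\<Sum>i=1..n. (x \<bullet> u i)\<^sup>2)" for x
    using orthonormal_Parseval[of u x] u_orth unfolding dim by blast
  have parseval_e: "(norm x)\<^sup>2 = (\<Sum>i=1..n. (x \<bullet> e i)\<^sup>2)" for x
    using orthonormal_Parseval[of e x] e_orth unfolding dim by blast
  have tri: "y \<bullet> v i = (\<Sum>j=1..i. (v i \<bullet> u j) * (y \<bullet> u j))" if "i \<in> {1..n}" for i y
    by (subst u_tri[OF that, THEN conjunct1]) (simp add: inner_sum_right)
  have norm_v: "\<bar>norm (v i) - 1\<bar> \<le> \<epsilon>" for i
    using f_norm[OF e_D[of i]] by (simp add: v_def norm_e)
  have inner_v: "2 * \<bar>v i \<bullet> v j\<bar> \<le> (4 + 2 * sqrt 2 + \<epsilon>) * \<epsilon>"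
    if "i \<in> {1..n}" "j \<in> {1..n}" "i \<noteq> j" for i j
  proof -
    have "1 \<le> sqrt 2" by simp
    then have "\<epsilon> \<le> norm (e i - e j)" using dist_e[OF that] eps1 by linarith
    then have "\<bar>v i \<bullet> v j - e i \<bullet> e j\<bar> \<le> \<epsilon> * (norm (e i) + norm (e j) + norm (e i - e j) + \<epsilon> / 2)"
      unfolding v_def by (intro inner_perturbation(2) f_norm f_dist e_D)
    then show ?thesis using that by (simp add: e_orth norm_e dist_e algebra_simps)
  qed
  have coeff: "1 - real (?c j j) * \<epsilon> \<le> v j \<bullet> u j \<and>
      (\<forall>i\<in>{j<..n}. \<bar>v i \<bullet> u j\<bar> \<le> real (?c i j) * \<epsilon>)" if "j \<in> {1..n}" for j
  proof (rule triangular_coefficients_bound[of \<epsilon> n v u, OF eps0])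
    show "1 - \<epsilon> \<le> norm (v i)" for i using norm_v[of i] by linarith
  qed (use eps1 inner_v diag tri u_tri that in auto)
  \<comment> \<open>the orthogonal map with \<open>U e\<^sub>i = u\<^sub>i\<close>\<close>
  define U where "U = (\<lambda>x. \<Sum>i=1..n. (x \<bullet> e i) *\<^sub>R u i)"
  have U_coord: "U x \<bullet> u j = x \<bullet> e j" if "j \<in> {1..n}" for x j
  proof -
    have "U x \<bullet> u j = (\<Sum>i=1..n. if i = j then x \<bullet> e i else 0)"
      unfolding U_def inner_sum_left using that by (intro sum.cong) (auto simp: u_orth)
    then show ?thesis using that by simp
  qed
  have "norm (U x - U y) = norm (x - y)" for x y
  proof -
    have "(norm (U x - U y))\<^sup>2 = (norm (x - y))\<^sup>2"
      unfolding parseval[of "U x - U y"] parseval_e[of "x - y"]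
      by (intro sum.cong) (simp_all add: inner_diff_left U_coord)
    then show ?thesis by simp
  qed
  then have "isometry_on D U" by (simp add: isometry_on_def)
  moreover have "norm (f x - U x) \<le> sqrt (\<Sum>i=1..n. ((2 + (\<Sum>j=1..i. real (?c i j))) * d + 4
      + (\<Sum>j=1..i. real (?c i j)))\<^sup>2) * \<epsilon>" if x: "x \<in> D" for x
  proof -
    have norm_x: "norm x \<le> d" using x assms(5) by auto
    have coord_le: "\<bar>f x \<bullet> u j\<bar> \<le> d + \<epsilon>" if "j \<in> {1..n}" for j
    proof -
      have "norm (u j) = 1" using u_orth[OF that that] by (simp add: norm_eq_1)
      then show ?thesis
        using Cauchy_Schwarz_ineq2[of "f x" "u j"] f_norm[OF x] norm_x by simp
    qed
    have row: "\<bar>(f x - U x) \<bullet> u i\<bar>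
        \<le> ((2 + (\<Sum>j=1..i. real (?c i j))) * d + 4 + (\<Sum>j=1..i. real (?c i j))) * \<epsilon>"
      (is "_ \<le> ((2 + ?S) * d + 4 + ?S) * \<epsilon>") if i: "i \<in> {1..n}" for i
    proof -
      have split: "{1..i} = insert i {1..<i}" using i by auto
      have "norm (x - e i) \<le> d + 1"
        using norm_triangle_ineq4[of x "e i"] norm_x by (simp add: norm_e)
      then have "\<epsilon> * (norm x + norm (e i) + norm (x - e i) + \<epsilon>) \<le> \<epsilon> * (2 * d + 2 + \<epsilon>)"
        using eps0 norm_x by (intro mult_left_mono) (auto simp: norm_e)
      moreover have "\<bar>f x \<bullet> v i - x \<bullet> e i\<bar> \<le> \<epsilon> * (norm x + norm (e i) + norm (x - e i) + \<epsilon>)"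
        unfolding v_def by (intro inner_perturbation(1) f_norm f_dist e_D x)
      ultimately have inner_err: "\<bar>f x \<bullet> v i - x \<bullet> e i\<bar> \<le> \<epsilon> * (2 * d + 2 + \<epsilon>)" by linarith
      \<comment> \<open>row \<open>i\<close> of the identity minus row \<open>i\<close> of the triangular matrix\<close>
      define \<delta> where "\<delta> = (\<lambda>j. (if j = i then 1 else 0) - v i \<bullet> u j)"
      have \<delta>: "\<bar>\<delta> j\<bar> \<le> real (?c i j) * \<epsilon>" if j: "j \<in> {1..i}" for j
      proof (cases "j = i")
        case True
        \<comment> \<open>The recursion controls the diagonal entry from below only; from above it is at most
          \<open>norm (v i) \<le> 1 + \<epsilon>\<close>, which suffices because \<open>c\<^sub>i\<^sub>i \<ge> 1\<close>.\<close>
        have "norm (u i) = 1" using u_orth[OF i i] by (simp add: norm_eq_1)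
        then have "v i \<bullet> u i \<le> 1 + \<epsilon>"
          using norm_cauchy_schwarz[of "v i" "u i"] norm_v[of i] by simp
        moreover have "1 * \<epsilon> \<le> real (?c i i) * \<epsilon>"
          using stab_coeff_diagonal(1)[of i \<epsilon>] i eps0 by (intro mult_right_mono) auto
        ultimately show ?thesis using coeff[OF i] True by (simp add: \<delta>_def abs_le_iff)
      next
        case False
        then show ?thesis using coeff[of j] i j by (auto simp: \<delta>_def)
      qed
      have "(f x - U x) \<bullet> u i = (f x \<bullet> v i - x \<bullet> e i) + (\<Sum>j=1..i. \<delta> j * (f x \<bullet> u j))"
      proof -
        have "(\<Sum>j=1..i. \<delta> j * (f x \<bullet> u j)) + f x \<bullet> v i
            = (\<Sum>j=1..i. if j = i then f x \<bullet> u j else 0)"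
          unfolding tri[OF i] sum.distrib[symmetric]
          by (intro sum.cong) (auto simp: \<delta>_def algebra_simps)
        also have "\<dots> = f x \<bullet> u i" using i by simp
        finally show ?thesis using U_coord[OF i, of x] by (simp add: inner_diff_left)
      qed
      moreover have "\<bar>\<Sum>j=1..i. \<delta> j * (f x \<bullet> u j)\<bar> \<le> ?S * \<epsilon> * (d + \<epsilon>)"
        unfolding sum_distrib_right
      proof (rule sum_abs[THEN order_trans], rule sum_mono)
        fix j assume "j \<in> {1..i}"
        then show "\<bar>\<delta> j * (f x \<bullet> u j)\<bar> \<le> real (?c i j) * \<epsilon> * (d + \<epsilon>)"
          unfolding abs_mult using i eps0 by (intro mult_mono \<delta> coord_le) auto
      qed
      ultimately have "\<bar>(f x - U x) \<bullet> u i\<bar> \<le> \<epsilon> * (2 * d + 2 + \<epsilon>) + ?S * \<epsilon> * (d + \<epsilon>)"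
        using inner_err by linarith
      also have "\<dots> = ((2 + ?S) * d + (2 + \<epsilon>) + ?S * \<epsilon>) * \<epsilon>" by (simp add: algebra_simps)
      also have "\<dots> \<le> ((2 + ?S) * d + 4 + ?S) * \<epsilon>"
      proof (intro mult_right_mono add_mono order_refl)
        have "0 \<le> ?S" by (intro sum_nonneg) simp
        then show "?S * \<epsilon> \<le> ?S" using eps1 by (intro mult_left_le) auto
      qed (use eps0 eps1 assms(3) in auto)
      finally show ?thesis .
    qed
    let ?B = "\<lambda>i. (2 + (\<Sum>j=1..i. real (?c i j))) * d + 4 + (\<Sum>j=1..i. real (?c i j))"
    have "(norm (f x - U x))\<^sup>2 \<le> (\<Sum>i=1..n. (?B i * \<epsilon>)\<^sup>2)"
      unfolding parseval
    proof (rule sum_mono)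
      fix i assume "i \<in> {1..n}"
      then have "\<bar>(f x - U x) \<bullet> u i\<bar> \<le> ?B i * \<epsilon>" by (rule row)
      then have "\<bar>(f x - U x) \<bullet> u i\<bar>\<^sup>2 \<le> (?B i * \<epsilon>)\<^sup>2" by (intro power_mono) auto
      then show "((f x - U x) \<bullet> u i)\<^sup>2 \<le> (?B i * \<epsilon>)\<^sup>2" by simp
    qed
    also have "\<dots> = (\<Sum>i=1..n. (?B i)\<^sup>2) * \<epsilon>\<^sup>2"
      by (simp add: sum_distrib_right power_mult_distrib)
    finally have "norm (f x - U x) \<le> sqrt ((\<Sum>i=1..n. (?B i)\<^sup>2) * \<epsilon>\<^sup>2)"
      by (rule real_le_rsqrt)
    then show ?thesis using eps0 by (simp add: real_sqrt_mult)
  qed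
  ultimately show ?thesis by blast
qed

end
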